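(* Let $r\ge2$ be a natural number and let $\mathcal{W}_r$ be an additive complement of the set of $r$-th powers $\mathcal{S}_r=\{1^r,2^r,3^r,\dots\}$. Then $$\sum_{n\le N} f_r(n)-N\gg N^{1-\frac1r}$$ for all sufficiently large $N$, where the implied constant depends only on $r$, and $$f_r(n)=\#\{(w,m^r)\in\mathcal{W}_r\times\mathcal{S}_r: n=w+m^r\}.$$
   Context: $\mathbb{N}=\{1,2,3,\dots\}$. A set $\mathcal{W}_r\subset\mathbb{N}$ is an additive complement of $\mathcal{S}_r$ if all sufficiently large integers can be written as the sum of an element of $\mathcal{W}_r$ and an element of $\mathcal{S}_r$. Sums over $n\le N$ run over integers $1\le n\le N$. The notation $F(N)\gg G(N)$ for all sufficiently large $N$ means there are a constant $C>0$ (the implied constant) and an $N_0$ with $F(N)\ge C\,G(N)$ for all integers $N\ge N_0$; here $C$ depends only on $r$, while $N_0$ may depend on $\mathcal{W}_r$. *)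

theory Defs
  imports Complex_Main
begin

(* The natural numbers of the mathematical text start at 1, hence the base m \<ge> 1 here
   and the condition 0 \<notin> W in additive_complement. *)
definition powers :: "nat \<Rightarrow> nat set" where
  "powers r = {m ^ r |m. m \<ge> 1}"

definition additive_complement :: "nat set \<Rightarrow> nat set \<Rightarrow> bool" where
  "additive_complement W S \<longleftrightarrow>
     0 \<notin> W \<and> (\<exists>n0. \<forall>n\<ge>n0. \<exists>w\<in>W. \<exists>s\<in>S. n = w + s)"

(* The set counted is finite for every W and S, being contained in {..n} \<times> {..n}. *)
definition rep_count :: "nat set \<Rightarrow> nat set \<Rightarrow> nat \<Rightarrow> nat" where
  "rep_count W S n = card {(w, s) \<in> W \<times> S. n = w + s}"

end

theory Submission
  imports Defs
begin

text \<open>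
  The sums \<open>w + m\<^sup>r\<close> cover each large integer about once, but the differences
  \<open>w - m\<^sup>r\<close> do not: unless the sums already coincide far too often, an additive
  complement has about \<open>y\<^bsup>1-1/r\<^esup>\<close> elements of size about \<open>y\<close>, and for each of
  them about \<open>D y\<^bsup>1/r-1\<^esup>\<close> values of \<open>m\<close> satisfy \<open>0 < w - m\<^sup>r \<le> D\<close>. Hence every scale \<open>y\<close> between \<open>D\<close> and \<open>N\<close> contributes a
  constant times \<open>D\<close> pairs, and once \<open>N/D\<close> is a large constant, there are at least \<open>2D\<close>
  pairs. By pigeonhole there are at least \<open>D\<close> coincidences
  \<open>w - m\<^sup>r = w' - m'\<^sup>r\<close>, and each is a coincidence \<open>w + m'\<^sup>r = w' + m\<^sup>r\<close>
  of sums. An integer \<open>n \<le> N\<close> has \<open>f n = O(N\<^bsup>1/r\<^esup>)\<close> representations and so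
  accounts for at most \<open>f n (f n - 1) = O(N\<^bsup>1/r\<^esup> (f n - 1))\<close> of them; summing over \<open>n\<close>
  bounds the sum of the \<open>f n - 1\<close> below by a multiple of \<open>D N\<^bsup>-1/r\<^esup>\<close>.
\<close>

section \<open>Powers in short intervals, and collisions of a map\<close>

text \<open>A mean value bound: the derivative \<open>s * x ^ (s - 1)\<close> is largest at the
  right endpoint.\<close>

lemma power_add_le:
  fixes c i :: nat
  shows "(c + i) ^ s \<le> c ^ s + i * s * (c + i) ^ (s - 1)"
proof (induction s)
  case (Suc s)
  have eq: "s * (c + i) ^ (s - 1) * (c + i) = s * (c + i) ^ s"
    by (cases s) (auto simp: algebra_simps)
  have "(c + i) ^ Suc s \<le> (c ^ s + i * s * (c + i) ^ (s - 1)) * (c + i)"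
    using mult_le_mono1[OF Suc.IH, of "c + i"] by (simp add: mult.commute)
  also have "\<dots> = c ^ Suc s + i * c ^ s + i * (s * (c + i) ^ (s - 1) * (c + i))"
    by (simp add: algebra_simps)
  also have "\<dots> \<le> c ^ Suc s + i * (c + i) ^ s + i * (s * (c + i) ^ s)"
    unfolding eq by (intro add_mono mult_le_mono2 power_mono order.refl) auto
  finally show ?case
    by (simp add: algebra_simps)
qed auto

text \<open>Consecutive \<open>r\<close>-th powers up to \<open>Q ^ r\<close> differ by at most
  \<open>r * Q ^ (r - 1)\<close>, so the \<open>t\<close> largest bases with power below
  \<open>w\<close> still have their powers within \<open>k ^ r\<close> of \<open>w\<close>.\<close>

lemma card_powers_in_window:
  fixes k r t w Q :: nat
  assumes r: "r \<ge> 1" and w: "k ^ r < w" "w \<le> Q ^ r" and t: "t * r * Q ^ (r - 1) \<le> k ^ r"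
  shows "t \<le> card {m. m \<ge> 1 \<and> m ^ r < w \<and> w \<le> m ^ r + k ^ r}"
proof -
  let ?S = "{m. m \<ge> 1 \<and> m ^ r < w \<and> w \<le> m ^ r + k ^ r}"
  \<comment> \<open>This \<open>p\<close> turns out to be the largest base with power below
    \<open>w\<close>; the bases counted are the \<open>t\<close> consecutive ones ending at
    \<open>p\<close>.\<close>
  define p where "p = (LEAST p. w \<le> Suc p ^ r)"
  have "w \<le> Suc Q ^ r"
    using w(2) power_mono[of Q "Suc Q" r] by linarith
  then have p: "w \<le> Suc p ^ r"
    unfolding p_def by (rule LeastI)
  have p': "p ^ r < w"
  proof (cases p)
    case 0
    then show ?thesis using w r by (simp add: power_0_left)
  next
    case (Suc p0)
    then have "\<not> w \<le> Suc p0 ^ r"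
      using not_less_Least[of p0 "\<lambda>p. w \<le> Suc p ^ r"] by (auto simp: p_def)
    then show ?thesis using Suc by simp
  qed
  have "p ^ r < Q ^ r" using p' w by linarith
  then have pQ: "Suc p \<le> Q" using power_less_imp_less_base by fastforce
  \<comment> \<open>Descending \<open>i\<close> bases from \<open>Suc p\<close> costs at most
    \<open>k ^ r\<close>. As \<open>k ^ r < w \<le> Suc p ^ r\<close>, the descent cannot reach base
    0.\<close>
  have key: "w \<le> (Suc p - i) ^ r + k ^ r \<and> i \<le> p" if i: "i \<le> t" for i
  proof -
    have b: "i * r * Suc p ^ (r - 1) \<le> k ^ r"
    proof -
      have "i * r * Suc p ^ (r - 1) \<le> t * r * Q ^ (r - 1)"
        by (intro mult_le_mono power_mono i pQ) auto
      then show ?thesis using t by linarith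
    qed
    have "Suc p ^ r = Suc p * Suc p ^ (r - 1)"
      using r by (simp add: power_eq_if)
    moreover have "i * Suc p ^ (r - 1) \<le> i * r * Suc p ^ (r - 1)"
      using r by simp
    ultimately have "i * Suc p ^ (r - 1) < Suc p * Suc p ^ (r - 1)"
      using b w p by linarith
    then have ip: "i \<le> p" by (simp only: mult_less_cancel2) linarith
    have "Suc p ^ r \<le> (Suc p - i) ^ r + i * r * Suc p ^ (r - 1)"
      using power_add_le[of "Suc p - i" i r] ip by simp
    with b p ip show ?thesis by linarith
  qed
  have "(\<lambda>i. Suc p - i) ` {1..t} \<subseteq> ?S"
  proof
    fix m assume "m \<in> (\<lambda>i. Suc p - i) ` {1..t}"
    then obtain i where i: "1 \<le> i" "i \<le> t" "m = Suc p - i" by auto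
    have "m \<le> p" using i by simp
    then have "m ^ r \<le> p ^ r" by (rule power_mono) simp
    then show "m \<in> ?S" using key[OF i(2)] i p' by auto
  qed
  moreover have "inj_on (\<lambda>i. Suc p - i) {1..t}"
    using key by (fastforce intro!: inj_onI)
  moreover have "finite ?S"
  proof (rule finite_subset)
    show "?S \<subseteq> {..w}"
    proof
      fix m assume m: "m \<in> ?S"
      then have "m \<le> m ^ r" using r by (intro self_le_power) auto
      with m show "m \<in> {..w}" by simp
    qed
  qed simp
  ultimately have "card {1..t} \<le> card ?S"
    by (metis (no_types, lifting) card_inj_on_le)
  then show ?thesis by simp
qed

text \<open>One representative is fixed in each fibre of \<open>\<phi>\<close>; \<open>Y\<close>
  consists of the other elements, and \<open>g\<close> sends each of them to the representative of
  its fibre.\<close>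

lemma collisions_of_large_set:
  assumes "finite X"
  obtains Y g where "Y \<subseteq> X" "card X \<le> card Y + card (\<phi> ` X)"
    "\<And>y. y \<in> Y \<Longrightarrow> g y \<in> X \<and> g y \<noteq> y \<and> \<phi> (g y) = \<phi> y"
proof -
  define R where "R = inv_into X \<phi> ` \<phi> ` X"
  have "card R \<le> card (\<phi> ` X)"
    unfolding R_def using assms by (intro card_image_le) auto
  moreover have RX: "R \<subseteq> X"
    unfolding R_def by (auto simp: inv_into_into)
  then have "card X = card (X - R) + card R"
    using assms by (metis card_Diff_subset card_mono finite_subset le_add_diff_inverse2)
  ultimately have "card X \<le> card (X - R) + card (\<phi> ` X)"
    by linarith
  then show ?thesis
    by (intro that[of "X - R" "\<lambda>y. inv_into X \<phi> (\<phi> y)"])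
       (auto simp: R_def inv_into_into f_inv_into_f, metis image_eqI)
qed

section \<open>Representations and their excess over one per integer\<close>

locale power_complement =
  fixes r :: nat and W :: "nat set" and n0 :: nat
  assumes r2: "r \<ge> 2"
    and covered: "\<And>n. n \<ge> n0 \<Longrightarrow> \<exists>w\<in>W. \<exists>m\<ge>1. n = w + m ^ r"
begin

definition reps :: "nat \<Rightarrow> (nat \<times> nat) set" where
  "reps n = {(w, m). w \<in> W \<and> m \<ge> 1 \<and> w + m ^ r = n}"

text \<open>The subtraction is truncated: an \<open>n\<close> without representation contributes \<open>0\<close>.\<close>

definition excess :: "nat \<Rightarrow> nat" where
  "excess N = (\<Sum>n=1..N. card (reps n) - 1)"

lemma le_power: "m \<le> m ^ r" for m :: nat
proof (cases "m = 0")
  case False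
  then show ?thesis using r2 by (intro self_le_power) auto
qed simp

lemma finite_reps [simp]: "finite (reps n)"
proof (rule finite_subset)
  show "reps n \<subseteq> {..n} \<times> {..n}"
  proof clarify
    fix w m assume "(w, m) \<in> reps n"
    then show "w \<in> {..n} \<and> m \<in> {..n}"
      using le_power[of m] by (auto simp: reps_def)
  qed
qed simp

lemma rep_count_eq: "rep_count W (powers r) n = card (reps n)"
proof -
  have "{(w, s) \<in> W \<times> powers r. n = w + s} = (\<lambda>(w, m). (w, m ^ r)) ` reps n"
    by (auto simp: powers_def reps_def image_iff)
  moreover have "inj_on (\<lambda>(w, m). (w, m ^ r)) (reps n)"
    using r2 by (auto simp: inj_on_def reps_def power_eq_iff_eq_base)
  ultimately show ?thesis
    by (simp add: rep_count_def card_image)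
qed

lemma excess_mono: "N \<le> N' \<Longrightarrow> excess N \<le> excess N'"
  unfolding excess_def by (intro sum_mono2) auto

lemma sum_reps_le: "(\<Sum>n=1..N. card (reps n)) \<le> N + excess N"
proof -
  have "(\<Sum>n=1..N. card (reps n)) \<le> (\<Sum>n=1..N. 1 + (card (reps n) - 1))"
    by (intro sum_mono) auto
  also have "\<dots> = N + excess N"
    unfolding excess_def by (subst sum.distrib) simp
  finally show ?thesis .
qed

text \<open>The truncation in \<open>excess\<close> gains one for each \<open>n\<close> without a
  representation, and every such \<open>n\<close> is below \<open>n0\<close>.\<close>

lemma sum_reps_ge: "N + excess N \<le> (\<Sum>n=1..N. card (reps n)) + n0"
proof -
  have pos: "card (reps n) \<ge> 1" if "n \<ge> n0" for n
  proof -
    have "reps n \<noteq> {}" using covered[OF that] by (auto simp: reps_def)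
    then show ?thesis by (simp add: Suc_le_eq card_gt_0_iff)
  qed
  have "N + excess N = (\<Sum>n=1..N. 1 + (card (reps n) - 1))"
    unfolding excess_def by (subst sum.distrib) simp
  also have "\<dots> \<le> (\<Sum>n=1..N. card (reps n) + (if n < n0 then 1 else 0))"
    using pos by (intro sum_mono) (force simp: not_less)
  also have "\<dots> = (\<Sum>n=1..N. card (reps n)) + card {n \<in> {1..N}. n < n0}"
    by (subst sum.distrib) (simp add: sum.If_cases Int_def)
  also have "card {n \<in> {1..N}. n < n0} \<le> card {..<n0}"
    by (intro card_mono) auto
  finally show ?thesis by simp
qed

section \<open>Counting the complement up to a power\<close>

text \<open>Each pair of a \<open>w \<le> q ^ r\<close> and a base \<open>m \<le> q\<close>
  represents an integer up to \<open>2 * q ^ r\<close>, and these have at most one representation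
  each plus the excess.\<close>

lemma card_W_upper: "card (W \<inter> {..q ^ r}) * q \<le> 2 * q ^ r + excess (2 * q ^ r)"
proof -
  let ?A = "(W \<inter> {..q ^ r}) \<times> {1..q}" and ?B = "SIGMA n:{1..2 * q ^ r}. reps n"
  have "card ?A \<le> card ?B"
  proof (rule card_inj_on_le)
    show "inj_on (\<lambda>(w, m). (w + m ^ r, (w, m))) ?A"
      by (auto simp: inj_on_def)
    show "(\<lambda>(w, m). (w + m ^ r, (w, m))) ` ?A \<subseteq> ?B"
    proof
      fix z assume "z \<in> (\<lambda>(w, m). (w + m ^ r, (w, m))) ` ?A"
      then obtain w m where z: "z = (w + m ^ r, (w, m))"
        and wm: "w \<in> W" "w \<le> q ^ r" "1 \<le> m" "m \<le> q" by auto
      from wm have "m ^ r \<le> q ^ r" by (intro power_mono) auto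
      moreover have "m \<le> m ^ r" by (rule le_power)
      ultimately have "w + m ^ r \<in> {1..2 * q ^ r}" using wm by simp
      then show "z \<in> ?B" using wm z by (simp add: reps_def)
    qed
  qed auto
  then show ?thesis
    using sum_reps_le[of "2 * q ^ r"] by (simp add: card_cartesian_product)
qed

text \<open>An integer in \<open>{n0..q ^ r}\<close> can only be covered with
  \<open>w \<le> q ^ r\<close> and \<open>m \<le> q\<close>, so there must be enough such
  pairs.\<close>

lemma card_W_lower: "q ^ r \<le> card (W \<inter> {..q ^ r}) * q + n0"
proof -
  let ?A = "(W \<inter> {..q ^ r}) \<times> {1..q}"
  have "{n0..q ^ r} \<subseteq> (\<lambda>(w, m). w + m ^ r) ` ?A"
  proof
    fix n assume n: "n \<in> {n0..q ^ r}"
    then obtain w m where wm: "w \<in> W" "m \<ge> 1" "n = w + m ^ r"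
      using covered[of n] by auto
    with n have "m ^ r \<le> q ^ r" by auto
    then have "m \<le> q" using r2 by (simp add: power_mono_iff)
    with wm n show "n \<in> (\<lambda>(w, m). w + m ^ r) ` ?A" by force
  qed
  then have "card {n0..q ^ r} \<le> card ?A"
    by (rule surj_card_le[rotated]) simp
  then show ?thesis by (simp add: card_cartesian_product)
qed

text \<open>
  The scale factor \<open>12\<close> makes the upper bound \<open>3 q\<^bsup>r-1\<^esup>\<close> for the elements up to
  \<open>q\<^sup>r\<close> at most half of the lower bound \<open>(12 q)\<^bsup>r-1\<^esup>/2\<close> for those up to
  \<open>(12 q)\<^sup>r\<close>.
\<close>

lemma card_W_block:
  assumes k: "2 * n0 \<le> k" "k \<ge> 1" "k \<le> q" and ex: "excess (2 * q ^ r) \<le> k ^ r"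
  shows "(12 * q) ^ (r - 1) \<le> 4 * card (W \<inter> {q ^ r<..(12 * q) ^ r})"
proof -
  let ?a = "card (W \<inter> {..q ^ r})" and ?A = "card (W \<inter> {..(12 * q) ^ r})"
  have pw: "x ^ r = x ^ (r - 1) * x" for x :: nat
    using r2 by (simp add: power_eq_if)
  have "k ^ r \<le> q ^ r" using k by (intro power_mono) auto
  \<comment> \<open>The third \<open>q ^ r\<close> comes from the excess, which is at most
    \<open>k ^ r \<le> q ^ r\<close>.\<close>
  then have "?a * q \<le> 3 * q ^ (r - 1) * q"
    using card_W_upper[of q] ex by (simp only: mult.assoc flip: pw)
  then have a: "?a \<le> 3 * q ^ (r - 1)" using k by simp
  have "12 ^ 1 \<le> (12 :: nat) ^ (r - 1)" using r2 by (intro power_increasing) auto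
  then have "12 * q ^ (r - 1) \<le> (12 * q) ^ (r - 1)" by (simp add: power_mult_distrib)
  with a have a': "4 * ?a \<le> (12 * q) ^ (r - 1)" by linarith
  have A: "(12 * q) ^ (r - 1) \<le> 2 * ?A"
  proof (rule ccontr)
    assume "\<not> ?thesis"
    then have "(2 * ?A + 1) * (12 * q) \<le> (12 * q) ^ (r - 1) * (12 * q)"
      by (intro mult_le_mono1) simp
    moreover have "(12 * q) ^ (r - 1) * (12 * q) \<le> ?A * (12 * q) + n0"
      using card_W_lower[of "12 * q"] by (simp only: pw)
    ultimately have "(2 * ?A + 1) * (12 * q) \<le> ?A * (12 * q) + n0" by linarith
    \<comment> \<open>Since \<open>n0 \<le> k / 2 < 12 * q\<close>, the integers below
      \<open>n0\<close> are too few to make up the difference.\<close>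
    then show False using k by (simp add: algebra_simps)
  qed
  have "W \<inter> {..y} = (W \<inter> {..x}) \<union> (W \<inter> {x<..y})" if "x \<le> y" for x y
    using that by auto
  from this[of "q ^ r" "(12 * q) ^ r"]
  have "W \<inter> {..(12 * q) ^ r} = (W \<inter> {..q ^ r}) \<union> (W \<inter> {q ^ r<..(12 * q) ^ r})"
    by (simp add: power_mono)
  then have "?A \<le> ?a + card (W \<inter> {q ^ r<..(12 * q) ^ r})"
    by (metis card_Un_le)
  then show ?thesis using a' A by linarith
qed

section \<open>Close pairs, scale by scale\<close>

text \<open>The strict \<open>m ^ r < w\<close> leaves only \<open>D\<close> possible differences,
  and the bounds \<open>x\<close>, \<open>y\<close> allow adding up over disjoint scales.\<close>

definition close_pairs :: "nat \<Rightarrow> nat \<Rightarrow> nat \<Rightarrow> (nat \<times> nat) set" where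
  "close_pairs D x y = {(w, m). w \<in> W \<and> x < w \<and> w \<le> y \<and> m \<ge> 1 \<and> m ^ r < w \<and> w \<le> m ^ r + D}"

lemma finite_close_pairs [simp]: "finite (close_pairs D x y)"
proof (rule finite_subset)
  show "close_pairs D x y \<subseteq> {..y} \<times> {..y}"
  proof clarify
    fix w m assume "(w, m) \<in> close_pairs D x y"
    then show "w \<in> {..y} \<and> m \<in> {..y}"
      using le_power[of m] by (auto simp: close_pairs_def)
  qed
qed simp

text \<open>Each of the at least \<open>(12 * q) ^ (r - 1) / 4\<close> elements of the block has at
  least \<open>t\<close> bases, and \<open>t\<close> shrinks just as the block grows: the product is
  \<open>k ^ r / (4 * r)\<close> at every scale.\<close>

lemma card_close_pairs_block:
  assumes k: "2 * n0 \<le> k" "k \<ge> 1" "k \<le> q" and ex: "excess (2 * q ^ r) \<le> k ^ r"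
    and t: "t * r * (12 * q) ^ (r - 1) = k ^ r"
  shows "k ^ r \<le> 4 * r * card (close_pairs (k ^ r) (q ^ r) ((12 * q) ^ r))"
proof -
  let ?B = "W \<inter> {q ^ r<..(12 * q) ^ r}"
  let ?S = "\<lambda>w. {m. m \<ge> 1 \<and> m ^ r < w \<and> w \<le> m ^ r + k ^ r}"
  have fin: "finite (?S w)" for w
  proof (rule finite_subset)
    show "?S w \<subseteq> {..w}"
    proof
      fix m assume "m \<in> ?S w"
      with le_power[of m] show "m \<in> {..w}" by simp
    qed
  qed simp
  have kq: "k ^ r \<le> q ^ r" using k by (intro power_mono) auto
  have S: "t \<le> card (?S w)" if "w \<in> ?B" for w
  proof (rule card_powers_in_window)
    show "k ^ r < w" using kq that by (intro le_less_trans[OF kq]) simp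
    show "w \<le> (12 * q) ^ r" using that by simp
  qed (use r2 t in auto)
  have "close_pairs (k ^ r) (q ^ r) ((12 * q) ^ r) = (SIGMA w:?B. ?S w)"
    by (auto simp: close_pairs_def)
  then have "card (close_pairs (k ^ r) (q ^ r) ((12 * q) ^ r)) = (\<Sum>w\<in>?B. card (?S w))"
    using fin by simp
  also have "\<dots> \<ge> (\<Sum>w\<in>?B. t)" by (intro sum_mono S)
  finally have "card ?B * t \<le> card (close_pairs (k ^ r) (q ^ r) ((12 * q) ^ r))"
    by simp
  moreover have "k ^ r \<le> t * r * (4 * card ?B)"
    unfolding t[symmetric] by (intro mult_le_mono2 card_W_block[OF k ex])
  then have "k ^ r \<le> 4 * r * (card ?B * t)"
    by (simp only: mult_ac)
  ultimately show ?thesis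
    by (meson le_trans mult_le_mono2)
qed

text \<open>The \<open>J\<close> blocks from \<open>(12 ^ j * k) ^ r\<close> to
  \<open>(12 ^ (j + 1) * k) ^ r\<close> are disjoint and obey the same lower bound. The excess is
  monotone, so its bound at the top scale serves all of them.\<close>

lemma card_close_pairs:
  assumes l: "2 * n0 \<le> k" "k \<ge> 1" and k: "k = r * 12 ^ (J * (r - 1)) * l"
    and ex: "excess (2 * (12 ^ J * k) ^ r) \<le> k ^ r"
  shows "J * k ^ r \<le> 4 * r * card (close_pairs (k ^ r) 0 ((12 ^ J * k) ^ r))"
proof -
  have "j \<le> J \<Longrightarrow> j * k ^ r \<le> 4 * r * card (close_pairs (k ^ r) 0 ((12 ^ j * k) ^ r))" for j
  proof (induction j)
    case (Suc j)
    define q where "q = 12 ^ j * k"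
    \<comment> \<open>This is \<open>k / (r * 12 ^ ((j + 1) * (r - 1)))\<close>, an integer thanks
      to the factors \<open>r\<close> and \<open>12 ^ (J * (r - 1))\<close> of
      \<open>k\<close>.\<close>
    define t where "t = l * 12 ^ ((J - Suc j) * (r - 1))"
    let ?old = "close_pairs (k ^ r) 0 (q ^ r)"
      and ?new = "close_pairs (k ^ r) (q ^ r) ((12 * q) ^ r)"
    have kq: "k \<le> q" by (simp add: q_def)
    have "q \<le> 12 ^ J * k"
      unfolding q_def using Suc.prems by (intro mult_le_mono1 power_increasing) auto
    then have "excess (2 * q ^ r) \<le> k ^ r"
      using ex excess_mono[of "2 * q ^ r" "2 * (12 ^ J * k) ^ r"]
      by (meson le_trans mult_le_mono2 power_mono zero_le)
    moreover have "t * r * (12 * q) ^ (r - 1) = k ^ r"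
    proof -
      have "J * (r - 1) = (J - Suc j) * (r - 1) + Suc j * (r - 1)"
        using Suc.prems by (simp only: le_add_diff_inverse2 flip: add_mult_distrib)
      then have "k = t * r * (12 ^ Suc j) ^ (r - 1)"
        by (simp only: k t_def power_add power_mult mult_ac)
      moreover have "k ^ r = k * k ^ (r - 1)" using r2 by (simp add: power_eq_if)
      moreover have "12 * q = 12 ^ Suc j * k" by (simp add: q_def)
      ultimately show ?thesis by (metis mult.assoc power_mult_distrib)
    qed
    ultimately have "k ^ r \<le> 4 * r * card ?new"
      using card_close_pairs_block[OF l kq] by simp
    moreover have "j * k ^ r \<le> 4 * r * card ?old"
      using Suc by (simp add: q_def)
    moreover have "card ?old + card ?new = card (?old \<union> ?new)"
      by (rule card_Un_disjoint[symmetric], simp_all) (auto simp: close_pairs_def)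
    moreover have "close_pairs D 0 x \<union> close_pairs D x y = close_pairs D 0 y"
      if "x \<le> y" for D x y
      using that by (auto simp: close_pairs_def)
    from this[of "q ^ r" "(12 * q) ^ r"]
    have "?old \<union> ?new = close_pairs (k ^ r) 0 ((12 * q) ^ r)"
      by (simp add: power_mono)
    ultimately have "card (close_pairs (k ^ r) 0 ((12 * q) ^ r)) = card ?old + card ?new"
      and "k ^ r \<le> 4 * r * card ?new" and "j * k ^ r \<le> 4 * r * card ?old"
      by simp_all
    then have "Suc j * k ^ r \<le> 4 * r * card (close_pairs (k ^ r) 0 ((12 * q) ^ r))"
      by (simp only: mult_Suc add_mult_distrib2)
    moreover have "12 * q = 12 ^ Suc j * k" by (simp add: q_def)
    ultimately show ?case by (simp only:)
  qed simp
  then show ?thesis by simp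
qed

section \<open>From close pairs to coincident sums\<close>

lemma card_reps_le:
  assumes "n \<le> 2 * L ^ r"
  shows "card (reps n) \<le> 2 * L"
proof -
  have "2 ^ 1 \<le> (2 :: nat) ^ r" using r2 by (intro power_increasing) auto
  then have L: "2 * L ^ r \<le> (2 * L) ^ r" by (simp add: power_mult_distrib)
  have "card (reps n) \<le> card {1..2 * L}"
  proof (rule card_inj_on_le)
    show "inj_on snd (reps n)" by (auto simp: inj_on_def reps_def)
    show "snd ` reps n \<subseteq> {1..2 * L}"
    proof clarify
      fix w m assume wm: "(w, m) \<in> reps n"
      then have "m ^ r \<le> n" by (auto simp: reps_def)
      then have "m ^ r \<le> (2 * L) ^ r" using assms L by linarith
      then have "m \<le> 2 * L" using r2 by (subst (asm) power_mono_iff) auto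
      then show "snd (w, m) \<in> {1..2 * L}" using wm by (auto simp: reps_def)
    qed
  qed simp
  then show ?thesis by simp
qed

text \<open>From \<open>f\<close> representations arise \<open>f * (f - 1)\<close> ordered pairs;
  bounding the first factor by \<open>2 * L\<close> leaves terms that sum to the excess.\<close>

lemma card_colliding_reps:
  "card (SIGMA n:{1..2 * L ^ r}. {(p, q) \<in> reps n \<times> reps n. p \<noteq> q})
    \<le> 2 * L * excess (2 * L ^ r)"
proof -
  have "card {(p, q) \<in> reps n \<times> reps n. p \<noteq> q} \<le> 2 * L * (card (reps n) - 1)"
    if "n \<in> {1..2 * L ^ r}" for n
  proof -
    have "{(p, q) \<in> reps n \<times> reps n. p \<noteq> q} = (SIGMA p:reps n. reps n - {p})"
      by auto
    then have "card {(p, q) \<in> reps n \<times> reps n. p \<noteq> q} = card (reps n) * (card (reps n) - 1)"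
      by simp
    then show ?thesis using card_reps_le[of n L] that by simp
  qed
  moreover have "finite {(p, q) \<in> reps n \<times> reps n. p \<noteq> q}" for n
    by (rule finite_subset[of _ "reps n \<times> reps n"]) auto
  ultimately show ?thesis
    by (subst card_SigmaI) (auto simp: excess_def sum_distrib_left intro!: sum_mono)
qed

text \<open>Only \<open>D\<close> differences are possible, so all but at most \<open>D\<close>
  close pairs collide with a chosen representative, and exchanging bases turns each collision into
  two representations of one sum.\<close>

lemma card_close_pairs_le:
  "card (close_pairs D 0 (L ^ r)) \<le> D + 2 * L * excess (2 * L ^ r)"
proof -
  let ?X = "close_pairs D 0 (L ^ r)"
  let ?Z = "SIGMA n:{1..2 * L ^ r}. {(p, q) \<in> reps n \<times> reps n. p \<noteq> q}"
  let ?d = "\<lambda>(w, m). w - m ^ r"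
  obtain Y g where Y: "Y \<subseteq> ?X" "card ?X \<le> card Y + card (?d ` ?X)"
    and g: "\<And>y. y \<in> Y \<Longrightarrow> g y \<in> ?X \<and> g y \<noteq> y \<and> ?d (g y) = ?d y"
    using collisions_of_large_set[of ?X ?d] by auto
  have "?d ` ?X \<subseteq> {1..D}" by (auto simp: close_pairs_def)
  then have "card (?d ` ?X) \<le> D"
    using card_mono[of "{1..D}"] by fastforce
  moreover have "card Y \<le> card ?Z"
  proof (rule card_inj_on_le)
    \<comment> \<open>Injective because \<open>w\<close> survives in the first representation and
      \<open>m\<close> in the second.\<close>
    let ?h = "\<lambda>y. (fst y + snd (g y) ^ r, ((fst y, snd (g y)), (fst (g y), snd y)))"
    show "inj_on ?h Y" by (auto simp: inj_on_def)
    show "?h ` Y \<subseteq> ?Z"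
    proof
      fix z assume "z \<in> ?h ` Y"
      then obtain w m where y: "(w, m) \<in> Y" "z = ?h (w, m)" by auto
      obtain w' m' where g': "g (w, m) = (w', m')" by fastforce
      have wm: "(w, m) \<in> ?X" "(w', m') \<in> ?X" "(w', m') \<noteq> (w, m)" "w' - m' ^ r = w - m ^ r"
        using y Y g[of "(w, m)"] g' by auto
      \<comment> \<open>No subtraction is truncated, since \<open>m ^ r < w\<close> and
        \<open>m' ^ r < w'\<close>; hence equal differences give equal sums.\<close>
      then have "w + m' ^ r = w' + m ^ r" "w + m' ^ r \<le> 2 * L ^ r" "w + m' ^ r \<ge> 1"
        by (auto simp: close_pairs_def)
      then show "z \<in> ?Z" using wm y g' by (auto simp: reps_def close_pairs_def)
    qed
    show "finite ?Z"
      by (intro finite_SigmaI finite_subset[of _ "reps _ \<times> reps _"]) auto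
  qed
  ultimately show ?thesis
    using Y card_colliding_reps[of L] by linarith
qed

text \<open>
  Each scale contributes \<open>D/(4 r)\<close> close pairs, where \<open>D = k\<^sup>r\<close>, so \<open>8 r\<close> scales
  give the required \<open>2 D\<close>.
\<close>

lemma excess_lower:
  assumes l: "n0 \<le> l" "l \<ge> 1" and k: "k = r * 12 ^ (8 * r * (r - 1)) * l"
  shows "k ^ (r - 1) \<le> 2 * 12 ^ (8 * r) * excess (2 * (12 ^ (8 * r) * k) ^ r)"
proof -
  let ?L = "12 ^ (8 * r) * k" and ?e = "excess (2 * (12 ^ (8 * r) * k) ^ r)"
  have "2 * l \<le> r * l" using r2 by simp
  also have "\<dots> \<le> k" by (simp add: k)
  finally have k1: "2 * n0 \<le> k" "k \<ge> 1" using l by auto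
  have pw: "k ^ r = k * k ^ (r - 1)" using r2 by (simp add: power_eq_if)
  have "k ^ r \<le> 2 * ?L * ?e"
  \<comment> \<open>A large excess suffices by itself; a small one is what the count of close pairs
    requires.\<close>
  proof (cases "?e \<le> k ^ r")
    case True
    have "8 * r * k ^ r \<le> 4 * r * card (close_pairs (k ^ r) 0 (?L ^ r))"
      using card_close_pairs[OF k1 k True] .
    then have "(4 * r) * (2 * k ^ r) \<le> (4 * r) * card (close_pairs (k ^ r) 0 (?L ^ r))"
      by simp
    then have "2 * k ^ r \<le> card (close_pairs (k ^ r) 0 (?L ^ r))"
      using r2 by (subst (asm) mult_le_cancel1) auto
    then show ?thesis using card_close_pairs_le[of "k ^ r" ?L] by linarith
  next
    case False
    then have "k ^ r \<le> 1 * ?e" by simp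
    also have "\<dots> \<le> 2 * ?L * ?e" using k1 by (intro mult_le_mono1) (simp add: Suc_le_eq)
    finally show ?thesis .
  qed
  then have "k * k ^ (r - 1) \<le> k * (2 * 12 ^ (8 * r) * ?e)"
    by (simp add: pw mult_ac)
  then show ?thesis using k1 by (subst (asm) mult_le_cancel1) auto
qed

end

section \<open>Arbitrary \<open>N\<close> and the constants\<close>

text \<open>Squeezes an arbitrary \<open>N\<close> between constant multiples of
  \<open>l ^ r\<close>. The largest \<open>l\<close> with \<open>A * l ^ r \<le> N\<close> works,
  because \<open>l + 1 \<le> 2 * l\<close> and \<open>A \<le> A ^ r\<close>.\<close>

lemma exists_scale:
  fixes A N r l0 :: nat
  assumes "r \<ge> 1" "A \<ge> 1" "A * l0 ^ r \<le> N" "l0 \<ge> 1"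
  obtains l where "l \<ge> l0" "A * l ^ r \<le> N" "N \<le> (2 * A * l) ^ r"
proof -
  have bound: "l \<le> N" if "A * l ^ r \<le> N" for l
  proof -
    have "l \<le> l ^ r" using assms by (cases l) (auto intro: self_le_power)
    also have "\<dots> \<le> A * l ^ r" using assms by simp
    finally show ?thesis using that by simp
  qed
  define l where "l = (GREATEST l. A * l ^ r \<le> N)"
  have l: "A * l ^ r \<le> N" "l0 \<le> l"
    unfolding l_def using assms bound
    by (auto intro: GreatestI_nat[where P = "\<lambda>l. A * l ^ r \<le> N"] Greatest_le_nat)
  have "\<not> A * Suc l ^ r \<le> N"
  proof
    assume "A * Suc l ^ r \<le> N"
    then have "Suc l \<le> l"
      unfolding l_def using bound by (intro Greatest_le_nat) auto
    then show False by simp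
  qed
  then have "N \<le> A * Suc l ^ r" by simp
  also have "\<dots> \<le> A ^ r * (2 * l) ^ r"
    using assms l by (intro mult_le_mono power_mono self_le_power) auto
  also have "\<dots> = (2 * A * l) ^ r"
    by (simp add: power_mult_distrib mult_ac)
  finally show ?thesis using that l by blast
qed

theorem corollary1:
  fixes r :: nat
  assumes "r \<ge> 2"
  shows "\<exists>C::real. C > 0 \<and>
    (\<forall>W. additive_complement W (powers r) \<longrightarrow>
      (\<exists>N0::nat. \<forall>N\<ge>N0.
        (\<Sum>n=1..N. real (rep_count W (powers r) n)) - real N
          \<ge> C * real N powr (1 - 1 / real r)))"
proof -
  \<comment> \<open>With \<open>k = c * l\<close>, \<open>excess_lower\<close> takes the excess at
    \<open>2 * (b * k) ^ r = A * l ^ r\<close>. All four constants depend on \<open>r\<close>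
    alone.\<close>
  define b where "b = (12::nat) ^ (8 * r)"
  define c where "c = r * 12 ^ (8 * r * (r - 1))"
  define A where "A = 2 * (b * c) ^ r"
  \<comment> \<open>The factor \<open>(2 * A) ^ (r - 1)\<close> comes from
    \<open>N \<le> (2 * A * l) ^ r\<close>, and \<open>2 * b\<close> from the bound on
    \<open>l ^ (r - 1)\<close> by the excess; the remaining 2 gives up half the excess to absorb
    \<open>n0\<close>.\<close>
  define C where "C = 1 / (4 * real b * real (2 * A) ^ (r - 1))"
  have pos: "b \<ge> 1" "c \<ge> 1" "A \<ge> 1"
    using assms by (auto simp: b_def c_def A_def Suc_le_eq)
  then have "C > 0" by (simp add: C_def)
  moreover have "\<exists>N0::nat. \<forall>N\<ge>N0. (\<Sum>n=1..N. real (rep_count W (powers r) n)) - real N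
          \<ge> C * real N powr (1 - 1 / real r)"
    if W: "additive_complement W (powers r)" for W
  proof -
    obtain n0 where "\<forall>n\<ge>n0. \<exists>w\<in>W. \<exists>s\<in>powers r. n = w + s"
      using W by (auto simp: additive_complement_def)
    then interpret power_complement r W n0
      using assms by unfold_locales (auto simp: powers_def, blast)
    \<comment> \<open>Ensures \<open>n0 \<le> l\<close>, and also
      \<open>2 * n0 \<le> excess N\<close> because
      \<open>l \<le> l ^ (r - 1) \<le> 2 * b * excess N\<close>.\<close>
    define l0 where "l0 = 4 * b * n0 + 1"
    have "C * real N powr (1 - 1 / real r)
        \<le> (\<Sum>n=1..N. real (rep_count W (powers r) n)) - real N" if N: "A * l0 ^ r \<le> N" for N
    proof -
      obtain l where l: "l \<ge> l0" "A * l ^ r \<le> N" "N \<le> (2 * A * l) ^ r"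
        using exists_scale[OF _ _ N] assms pos by (auto simp: l0_def)
      have "n0 \<le> 4 * b * n0" using pos by simp
      then have l1: "n0 \<le> l" "l \<ge> 1" using l(1) unfolding l0_def by linarith+
      have "l ^ (r - 1) \<le> (c * l) ^ (r - 1)"
        using pos by (intro power_mono) auto
      also have "\<dots> \<le> 2 * b * excess (2 * (b * (c * l)) ^ r)"
        using excess_lower[OF l1 refl] by (simp add: b_def c_def)
      also have "2 * (b * (c * l)) ^ r = A * l ^ r"
        by (simp add: A_def power_mult_distrib)
      also have "2 * b * excess (A * l ^ r) \<le> 2 * b * excess N"
        by (intro mult_le_mono2 excess_mono l)
      finally have e: "l ^ (r - 1) \<le> 2 * b * excess N" .
      have "l \<le> l ^ (r - 1)" using l1 assms by (intro self_le_power) auto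
      moreover have "2 * b * (2 * n0) = 4 * b * n0" by simp
      ultimately have "2 * b * (2 * n0) \<le> 2 * b * excess N"
        using e l(1) unfolding l0_def by linarith
      then have n0: "2 * n0 \<le> excess N" using pos by (subst (asm) mult_le_cancel1) auto
      define x where "x = real (2 * A * l)"
      have x: "x > 0" using pos l1 by (simp add: x_def)
      have "real N \<le> real ((2 * A * l) ^ r)" using l(3) by (rule of_nat_mono)
      then have "real N powr (1 - 1 / real r) \<le> (x ^ r) powr (1 - 1 / real r)"
        using assms by (intro powr_mono2) (auto simp: x_def)
      also have "(x ^ r) powr (1 - 1 / real r) = x powr (real r * (1 - 1 / real r))"
        using x by (simp add: powr_powr flip: powr_realpow)
      also have "real r * (1 - 1 / real r) = real (r - 1)"
        using assms by (simp add: field_simps of_nat_diff)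
      also have "x powr real (r - 1) = x ^ (r - 1)"
        using x by (rule powr_realpow)
      also have "x ^ (r - 1) = real (2 * A) ^ (r - 1) * real (l ^ (r - 1))"
        by (simp add: x_def power_mult_distrib)
      also have "\<dots> \<le> real (2 * A) ^ (r - 1) * real (2 * b * excess N)"
        using e by (intro mult_left_mono of_nat_mono) auto
      finally have "C * real N powr (1 - 1 / real r)
          \<le> C * (real (2 * A) ^ (r - 1) * real (2 * b * excess N))"
        using \<open>C > 0\<close> by (intro mult_left_mono) auto
      also have "\<dots> = real (excess N) / 2"
        using pos by (simp add: C_def field_simps)
      also have "\<dots> \<le> real (excess N) - real n0"
        using n0 by linarith
      also have "\<dots> \<le> real (\<Sum>n=1..N. card (reps n)) - real N"
        using sum_reps_ge[of N] by linarith
      finally show ?thesis by (simp add: rep_count_eq)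
    qed
    then show ?thesis by blast
  qed
  ultimately show ?thesis by blast
qed

end
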